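(* For $\alpha>0$, $\alpha\neq 1/2$, set $\gamma(\alpha)=\alpha/(2\alpha-1)$ and $z(y,\alpha)=y^2(2\alpha-1)/2$, and for $y\in\mathbb{R}$ define \[ F(y,\alpha)= y\,M(\gamma(\alpha),3/2,z(y,\alpha))+\frac{\Gamma(1-\gamma(\alpha))}{\sqrt{2(1-2\alpha)}\,\Gamma(3/2-\gamma(\alpha))}\,M(\gamma(\alpha)-1/2,1/2,z(y,\alpha))\quad\text{if } 0<\alpha<1/2, \] \[ F(y,\alpha)= y\,M(\gamma(\alpha),3/2,z(y,\alpha))+\frac{\Gamma(\gamma(\alpha)-1/2)}{\sqrt{2(2\alpha-1)}\,\Gamma(\gamma(\alpha))}\,M(\gamma(\alpha)-1/2,1/2,z(y,\alpha))\quad\text{if } \alpha>1/2. \] For each such $\alpha$ the equation $B=F(B,\alpha)/F'(B,\alpha)$ (where $F'=\partial F/\partial y$) has exactly one positive solution $B=B(\alpha)$; let $C(\alpha)$ be the constant determined by $B(\alpha)=C(\alpha)F(B(\alpha),\alpha)$. Then: (i) If $0<\alpha<1/2$, the function $f(\cdot,\alpha)$ given by $f(y,\alpha)=C(\alpha)F(y,\alpha)$ for $y<B(\alpha)$ and $f(y,\alpha)=y$ for $y\ge B(\alpha)$ solves the differential equation in the free boundary problem (FBP) of the context, i.e. $f''(y,\alpha)-(2\alpha-1)yf'(y,\alpha)-f(y,\alpha)=0$ for $y<B(\alpha)$. (ii) If $\alpha=1/2$, the free boundary problem (FBP) is solved by $f(y,1/2)=e^{y-1}$ for $y<1$ and $f(y,1/2)=y$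 for $y\ge 1$ (with $B(1/2)=1$). (iii) If $\alpha>1/2$, the function $f(\cdot,\alpha)$ given by $f(y,\alpha)=C(\alpha)F(y,\alpha)$ for $y<B(\alpha)$ and $f(y,\alpha)=y$ for $y\ge B(\alpha)$ solves the differential equation in (FBP), i.e. $f''(y,\alpha)-(2\alpha-1)yf'(y,\alpha)-f(y,\alpha)=0$ for $y<B(\alpha)$.
   Context: Primes denote derivatives with respect to $y$. $\Gamma$ is the Gamma function. $M$ is the confluent hypergeometric function of the first kind, \[ M(\gamma,\beta,z)=\sum_{n=0}^\infty \frac{\gamma^{(n)}z^n}{\beta^{(n)}\,n!},\qquad \gamma^{(0)}=1,\quad \gamma^{(n)}=(\gamma+n-1)\gamma^{(n-1)}. \] For $\alpha>0$, the free boundary problem (FBP) asks for a constant $B(\alpha)$ and a continuously differentiable function $f(\cdot,\alpha)$ on $\mathbb{R}$ with \[ \begin{cases} f''(y,\alpha)-(2\alpha-1)y f'(y,\alpha)-f(y,\alpha)=0, & y<B(\alpha),\\ f(y,\alpha)=y, & y=B(\alpha),\\ f'(y,\alpha)=1, & y=B(\alpha),\\ f(y,\alpha)\to 0, & y\to-\infty. \end{cases} \] *)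

theory Defs
  imports "HOL-Analysis.Analysis"
begin

definition kummer_M :: "real \<Rightarrow> real \<Rightarrow> real \<Rightarrow> real" where
  "kummer_M \<gamma> \<beta> z = (\<Sum>n. pochhammer \<gamma> n * z ^ n / (pochhammer \<beta> n * fact n))"

definition \<gamma>_par :: "real \<Rightarrow> real" where
  "\<gamma>_par \<alpha> = \<alpha> / (2 * \<alpha> - 1)"

definition z_arg :: "real \<Rightarrow> real \<Rightarrow> real" where
  "z_arg \<alpha> y = y\<^sup>2 * (2 * \<alpha> - 1) / 2"

text \<open>The parameter comes first, so that \<open>deriv (F \<alpha>)\<close> is the derivative in \<open>y\<close>.
  Only \<open>\<alpha> > 0\<close> with \<open>\<alpha> \<noteq> 1/2\<close> is meaningful; the value at \<open>\<alpha> = 1/2\<close> is never used.\<close>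

definition F :: "real \<Rightarrow> real \<Rightarrow> real" where
  "F \<alpha> y =
    (if \<alpha> < 1/2
     then y * kummer_M (\<gamma>_par \<alpha>) (3/2) (z_arg \<alpha> y)
        + Gamma (1 - \<gamma>_par \<alpha>) / (sqrt (2 * (1 - 2 * \<alpha>)) * Gamma (3/2 - \<gamma>_par \<alpha>))
          * kummer_M (\<gamma>_par \<alpha> - 1/2) (1/2) (z_arg \<alpha> y)
     else y * kummer_M (\<gamma>_par \<alpha>) (3/2) (z_arg \<alpha> y)
        + Gamma (\<gamma>_par \<alpha> - 1/2) / (sqrt (2 * (2 * \<alpha> - 1)) * Gamma (\<gamma>_par \<alpha>))
          * kummer_M (\<gamma>_par \<alpha> - 1/2) (1/2) (z_arg \<alpha> y))"

text \<open>Since division by zero yields zero, a positive \<open>B\<close> satisfying the equation below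
  automatically has \<open>deriv (F \<alpha>) B \<noteq> 0\<close> and \<open>F \<alpha> B \<noteq> 0\<close>.\<close>

definition is_boundary :: "real \<Rightarrow> real \<Rightarrow> bool" where
  "is_boundary \<alpha> B \<longleftrightarrow> B > 0 \<and> B = F \<alpha> B / deriv (F \<alpha>) B"

definition boundary :: "real \<Rightarrow> real" where
  "boundary \<alpha> = (THE B. is_boundary \<alpha> B)"

definition scaling :: "real \<Rightarrow> real" where
  "scaling \<alpha> = (THE C. boundary \<alpha> = C * F \<alpha> (boundary \<alpha>))"

definition f_sol :: "real \<Rightarrow> real \<Rightarrow> real" where
  "f_sol \<alpha> y = (if y < boundary \<alpha> then scaling \<alpha> * F \<alpha> y else y)"

text \<open>Twice differentiability is required explicitly because \<open>deriv\<close> is total.\<close>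

definition solves_ODE_below :: "real \<Rightarrow> real \<Rightarrow> (real \<Rightarrow> real) \<Rightarrow> bool" where
  "solves_ODE_below \<alpha> B f \<longleftrightarrow>
    (\<forall>y<B. f differentiable at y \<and> deriv f differentiable at y \<and>
       deriv (deriv f) y - (2 * \<alpha> - 1) * y * deriv f y - f y = 0)"

definition solves_FBP :: "real \<Rightarrow> real \<Rightarrow> (real \<Rightarrow> real) \<Rightarrow> bool" where
  "solves_FBP \<alpha> B f \<longleftrightarrow>
    f C1_differentiable_on UNIV \<and> solves_ODE_below \<alpha> B f \<and>
    f B = B \<and> deriv f B = 1 \<and> (f \<longlongrightarrow> 0) at_bot"

end

theory Submission imports Defs "HOL-Real_Asymp.Real_Asymp"
begin

text \<open>
  Put \<open>a = 2 * \<alpha> - 1 > -1\<close>. Kummer's equation gives \<open>F'' = a y F' + F\<close>, with \<open>F(0) > 0\<close> and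
  \<open>F'(0) = 1\<close>; beyond its sign, the Gamma quotient \<open>F(0)\<close> plays no role. The boundary equation says
  that \<open>G = F - y F'\<close> vanishes. If \<open>a > 0\<close>, then \<open>F\<close> and \<open>F'\<close> stay positive on the half-line and
  \<open>G' = -y (a y F' + F)\<close>, so \<open>G\<close> decreases from \<open>F(0) > 0\<close> to \<open>-\<infinity>\<close>. If \<open>a < 0\<close>, the same positivity
  argument applies to \<open>g = F exp (-a y\<^sup>2 / 2)\<close>, which solves \<open>g'' = -a y g' + (1 - a) g\<close>, and
  \<open>(G exp (-a y\<^sup>2 / 2))' = -(1 + a) y g\<close>, so again \<open>G\<close> has exactly one positive zero.
\<close>

section \<open>Kummer's power series and its differential equation\<close>

definition kummer_coeff :: "real \<Rightarrow> real \<Rightarrow> nat \<Rightarrow> real" where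
  "kummer_coeff \<gamma> \<beta> n = pochhammer \<gamma> n / (pochhammer \<beta> n * fact n)"

lemma kummer_M_powser: "kummer_M \<gamma> \<beta> = (\<lambda>z. \<Sum>n. kummer_coeff \<gamma> \<beta> n * z ^ n)"
  by (simp add: kummer_M_def kummer_coeff_def fun_eq_iff)

text \<open>This recurrence is Kummer's equation read coefficient by coefficient; \<beta> > 0 keeps
  every denominator nonzero.\<close>

lemma kummer_coeff_Suc:
  assumes "\<beta> > 0"
  shows "(\<beta> + real n) * (real n + 1) * kummer_coeff \<gamma> \<beta> (Suc n) = (\<gamma> + real n) * kummer_coeff \<gamma> \<beta> n"
proof -
  have "pochhammer \<beta> n \<noteq> 0" "\<beta> + real n \<noteq> 0"
    using assms pochhammer_pos[of \<beta> n] by auto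
  then show ?thesis
    by (simp add: kummer_coeff_def pochhammer_Suc divide_simps)
qed

text \<open>The ratio of consecutive terms is of order z / n, so the ratio test applies for every
  z.\<close>

lemma kummer_summable:
  assumes "\<beta> > 0"
  shows "summable (\<lambda>n. kummer_coeff \<gamma> \<beta> n * z ^ n)"
proof -
  define r where "r n = (\<gamma> + real n) / ((\<beta> + real n) * (real n + 1)) * z" for n
  have step: "kummer_coeff \<gamma> \<beta> (Suc n) * z ^ Suc n = r n * (kummer_coeff \<gamma> \<beta> n * z ^ n)" for n
  proof -
    have "(\<beta> + real n) * (real n + 1) \<noteq> 0" using assms by auto
    then have "kummer_coeff \<gamma> \<beta> (Suc n)
        = (\<gamma> + real n) * kummer_coeff \<gamma> \<beta> n / ((\<beta> + real n) * (real n + 1))"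
      using kummer_coeff_Suc[OF assms, of n \<gamma>] by (metis nonzero_mult_div_cancel_left)
    then show ?thesis by (simp add: r_def)
  qed
  have "r \<longlonglongrightarrow> 0 * z"
    unfolding r_def by (intro tendsto_mult tendsto_const) real_asymp
  then have "\<forall>\<^sub>F n in sequentially. \<bar>r n\<bar> < 1 / 2"
    by (intro order_tendstoD(2)[OF tendsto_rabs_zero]) auto
  then obtain N where N: "\<bar>r n\<bar> < 1 / 2" if "n \<ge> N" for n
    by (auto simp: eventually_sequentially)
  show ?thesis
  proof (rule summable_ratio_test[where c = "1 / 2" and N = N])
    fix n assume "n \<ge> N"
    then have "\<bar>r n\<bar> * \<bar>kummer_coeff \<gamma> \<beta> n * z ^ n\<bar> \<le> 1 / 2 * \<bar>kummer_coeff \<gamma> \<beta> n * z ^ n\<bar>"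
      by (intro mult_right_mono[OF less_imp_le[OF N]]) auto
    then show "norm (kummer_coeff \<gamma> \<beta> (Suc n) * z ^ Suc n) \<le> 1 / 2 * norm (kummer_coeff \<gamma> \<beta> n * z ^ n)"
      unfolding step by (simp add: abs_mult)
  qed simp
qed

text \<open>\<open>M1\<close> and \<open>M2\<close> are the termwise derivatives, available on all
  of the real line since the radius of convergence is infinite. Comparing coefficients turns the
  recurrence into Kummer's equation.\<close>

lemma kummer_M_derivs:
  assumes "\<beta> > 0"
  obtains M1 M2 where
    "\<And>z. (kummer_M \<gamma> \<beta> has_real_derivative M1 z) (at z)"
    "\<And>z. (M1 has_real_derivative M2 z) (at z)"
    "\<And>z. z * M2 z + (\<beta> - z) * M1 z = \<gamma> * kummer_M \<gamma> \<beta> z"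
proof -
  define c where "c = kummer_coeff \<gamma> \<beta>"
  have s0: "summable (\<lambda>n. c n * z ^ n)" for z
    unfolding c_def by (rule kummer_summable[OF assms])
  have s1: "summable (\<lambda>n. diffs c n * z ^ n)" for z
    by (rule termdiff_converges_all[OF s0])
  have s2: "summable (\<lambda>n. diffs (diffs c) n * z ^ n)" for z
    by (rule termdiff_converges_all[OF s1])
  show ?thesis
  proof (rule that)
    fix z
    show "(kummer_M \<gamma> \<beta> has_real_derivative (\<Sum>n. diffs c n * z ^ n)) (at z)"
      using termdiffs_strong_converges_everywhere[OF s0] by (simp add: kummer_M_powser c_def)
    show "((\<lambda>z. \<Sum>n. diffs c n * z ^ n) has_real_derivative (\<Sum>n. diffs (diffs c) n * z ^ n)) (at z)"
      by (rule termdiffs_strong_converges_everywhere[OF s1])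
    \<comment> \<open>Multiplication by z undoes the index shift of \<open>diffs\<close>; the term
      restored at index 0 is zero.\<close>
    have zd: "(\<lambda>n. real n * d n * z ^ n) sums (z * (\<Sum>n. diffs d n * z ^ n))"
      if "summable (\<lambda>n. diffs d n * z ^ n)" for d
    proof -
      have "(\<lambda>n. z * (diffs d n * z ^ n)) sums (z * (\<Sum>n. diffs d n * z ^ n))"
        by (intro sums_mult summable_sums that)
      then have "(\<lambda>n. real (Suc n) * d (Suc n) * z ^ Suc n) sums (z * (\<Sum>n. diffs d n * z ^ n))"
        by (simp add: diffs_def algebra_simps)
      then show ?thesis by (subst (asm) sums_Suc_iff) simp
    qed
    have "(\<lambda>n. real n * diffs c n * z ^ n + \<beta> * (diffs c n * z ^ n) - real n * c n * z ^ n)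
        sums (z * (\<Sum>n. diffs (diffs c) n * z ^ n) + \<beta> * (\<Sum>n. diffs c n * z ^ n)
              - z * (\<Sum>n. diffs c n * z ^ n))"
      by (intro sums_add sums_diff zd s1 s2 sums_mult summable_sums)
    moreover have "real n * diffs c n * z ^ n + \<beta> * (diffs c n * z ^ n) - real n * c n * z ^ n
        = \<gamma> * (c n * z ^ n)" for n
    proof -
      have "real n * diffs c n + \<beta> * diffs c n - real n * c n = \<gamma> * c n"
        using kummer_coeff_Suc[OF assms, of n \<gamma>] by (simp add: diffs_def c_def algebra_simps)
      then show ?thesis by (metis (no_types, opaque_lifting) left_diff_distrib distrib_right mult.assoc)
    qed
    ultimately have "(\<lambda>n. \<gamma> * (c n * z ^ n))
        sums (z * (\<Sum>n. diffs (diffs c) n * z ^ n) + \<beta> * (\<Sum>n. diffs c n * z ^ n)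
              - z * (\<Sum>n. diffs c n * z ^ n))" by simp
    moreover have "(\<lambda>n. \<gamma> * (c n * z ^ n)) sums (\<gamma> * kummer_M \<gamma> \<beta> z)"
      unfolding kummer_M_powser c_def[symmetric] by (intro sums_mult summable_sums s0)
    ultimately show "z * (\<Sum>n. diffs (diffs c) n * z ^ n) + (\<beta> - z) * (\<Sum>n. diffs c n * z ^ n)
        = \<gamma> * kummer_M \<gamma> \<beta> z"
      by (metis (no_types, lifting) sums_unique2 add_diff_eq left_diff_distrib)
  qed
qed

lemma kummer_M_0 [simp]: "kummer_M \<gamma> \<beta> 0 = 1"
  using powser_zero[of "kummer_coeff \<gamma> \<beta>"] by (simp add: kummer_M_powser kummer_coeff_def)

text \<open>The substitution z = a y^2 / 2 turns Kummer's equation into f'' = a y f' + f. The two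
  summands are its odd solution and K times its even solution.\<close>

lemma kummer_combination_ODE:
  fixes a K :: real
  assumes "a \<noteq> 0"
    and f_def: "f = (\<lambda>y. y * kummer_M (1 / (2 * a) + 1 / 2) (3 / 2) (y\<^sup>2 * a / 2)
                  + K * kummer_M (1 / (2 * a)) (1 / 2) (y\<^sup>2 * a / 2))"
  obtains f' where
    "\<And>y. (f has_real_derivative f' y) (at y)"
    "\<And>y. (f' has_real_derivative a * y * f' y + f y) (at y)"
    "f 0 = K" "f' 0 = 1"
proof -
  obtain M1 M2 where M:
    "\<And>z. (kummer_M (1 / (2 * a) + 1 / 2) (3 / 2) has_real_derivative M1 z) (at z)"
    "\<And>z. (M1 has_real_derivative M2 z) (at z)"
    "\<And>z. z * M2 z + (3 / 2 - z) * M1 z = (1 / (2 * a) + 1 / 2) * kummer_M (1 / (2 * a) + 1 / 2) (3 / 2) z"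
    by (rule kummer_M_derivs[of "3 / 2" "1 / (2 * a) + 1 / 2"]) auto
  obtain N1 N2 where N:
    "\<And>z. (kummer_M (1 / (2 * a)) (1 / 2) has_real_derivative N1 z) (at z)"
    "\<And>z. (N1 has_real_derivative N2 z) (at z)"
    "\<And>z. z * N2 z + (1 / 2 - z) * N1 z = (1 / (2 * a)) * kummer_M (1 / (2 * a)) (1 / 2) z"
    by (rule kummer_M_derivs[of "1 / 2" "1 / (2 * a)"]) auto
  define M0 where "M0 = kummer_M (1 / (2 * a) + 1 / 2) (3 / 2)"
  define N0 where "N0 = kummer_M (1 / (2 * a)) (1 / 2)"
  note [derivative_intros] =
    DERIV_chain2[OF M(1)[folded M0_def]] DERIV_chain2[OF M(2)]
    DERIV_chain2[OF N(1)[folded N0_def]] DERIV_chain2[OF N(2)]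
  define f' where "f' = (\<lambda>y. M0 (y\<^sup>2 * a / 2) + a * y\<^sup>2 * M1 (y\<^sup>2 * a / 2) + K * a * y * N1 (y\<^sup>2 * a / 2))"
  have f: "f = (\<lambda>y. y * M0 (y\<^sup>2 * a / 2) + K * N0 (y\<^sup>2 * a / 2))"
    by (simp add: f_def M0_def N0_def)
  show ?thesis
  proof (rule that)
    fix y
    define z where "z = y\<^sup>2 * a / 2"
    show "(f has_real_derivative f' y) (at y)"
      unfolding f f'_def
      by (rule derivative_eq_intros refl | simp)+ (simp add: algebra_simps power2_eq_square)
    have "(f' has_real_derivative
        3 * a * y * M1 z + a\<^sup>2 * y ^ 3 * M2 z + K * (a * N1 z + a\<^sup>2 * y\<^sup>2 * N2 z)) (at y)"
      unfolding f'_def z_def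
      by (rule derivative_eq_intros refl | simp)+
        (simp add: algebra_simps power2_eq_square power3_eq_cube)
    \<comment> \<open>The term z M1 is added and subtracted so that the left-hand side of Kummer's
      equation appears; the same is done for N1 below.\<close>
    moreover have "3 * a * y * M1 z + a\<^sup>2 * y ^ 3 * M2 z = 2 * a * y * (z * M1 z + (z * M2 z + (3 / 2 - z) * M1 z))"
      unfolding z_def by (simp add: algebra_simps power2_eq_square power3_eq_cube)
    moreover have "a * N1 z + a\<^sup>2 * y\<^sup>2 * N2 z = 2 * a * (z * N1 z + (z * N2 z + (1 / 2 - z) * N1 z))"
      unfolding z_def by (simp add: algebra_simps power2_eq_square)
    moreover have "2 * a * y * (z * M1 z + (1 / (2 * a) + 1 / 2) * M0 z)
        + K * (2 * a * (z * N1 z + 1 / (2 * a) * N0 z)) = a * y * f' y + f y"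
      unfolding f f'_def z_def using assms(1)
      by (simp add: field_simps power2_eq_square)
    ultimately show "(f' has_real_derivative a * y * f' y + f y) (at y)"
      unfolding M(3) N(3) M0_def N0_def by simp
  qed (auto simp: f'_def f M0_def N0_def)
qed

section \<open>Positivity and the unique tangent through the origin\<close>

text \<open>The factor exp (- c y^2 / 2) cancels the first-order term: the weighted product f f' has
  derivative (f'^2 + d f^2) exp (- c y^2 / 2) \<ge> 0. Hence f f' stays positive for y \<ge> 0, so f
  cannot vanish there, and f and f' are both positive.\<close>

lemma second_order_ODE_increasing:
  fixes f f' :: "real \<Rightarrow> real"
  assumes f: "\<And>y. (f has_real_derivative f' y) (at y)"
    and f': "\<And>y. (f' has_real_derivative c * y * f' y + d * f y) (at y)"
    and "c \<ge> 0" "d \<ge> 0" "f 0 > 0" "f' 0 > 0" "y \<ge> 0"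
  shows "f' y > 0 \<and> f y \<ge> f 0"
proof -
  note [derivative_intros] = DERIV_chain2[OF f] DERIV_chain2[OF f']
  have prod: "f x * f' x > 0" if "x \<ge> 0" for x
  proof -
    let ?q = "\<lambda>x. f x * f' x * exp (- c * x\<^sup>2 / 2)"
    have "?q 0 \<le> ?q x"
    proof (rule DERIV_nonneg_imp_nondecreasing[OF that])
      fix t
      have "(?q has_real_derivative ((f' t)\<^sup>2 + d * (f t)\<^sup>2) * exp (- c * t\<^sup>2 / 2)) (at t)"
        by (rule derivative_eq_intros refl | simp)+ (simp add: algebra_simps power2_eq_square)
      then show "\<exists>r. (?q has_real_derivative r) (at t) \<and> 0 \<le> r"
        using \<open>d \<ge> 0\<close>
        by (intro exI[of _ "((f' t)\<^sup>2 + d * (f t)\<^sup>2) * exp (- c * t\<^sup>2 / 2)"] conjI) auto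
    qed
    moreover have "?q 0 > 0" using assms by simp
    ultimately have "?q x > 0" by linarith
    then show ?thesis by (simp add: zero_less_mult_iff)
  qed
  have cont: "continuous_on S f" for S
    using f by (meson DERIV_isCont continuous_at_imp_continuous_on)
  have pos: "f x > 0" if "x \<ge> 0" for x
  proof (rule ccontr)
    assume "\<not> f x > 0"
    have "\<exists>t\<ge>0. t \<le> x \<and> f t = 0"
      by (rule IVT2') (use \<open>\<not> f x > 0\<close> that \<open>f 0 > 0\<close> cont[of "{0..x}"] in simp_all)
    then obtain t where "0 \<le> t" "f t = 0" by blast
    then show False using prod[of t] by simp
  qed
  have pos': "f' x > 0" if "x \<ge> 0" for x
    using prod[OF that] pos[OF that] by (simp add: zero_less_mult_iff)
  have "f 0 \<le> f y"
  proof (rule DERIV_nonneg_imp_nondecreasing[OF \<open>y \<ge> 0\<close>])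
    fix x :: real assume "0 \<le> x"
    then show "\<exists>r. (f has_real_derivative r) (at x) \<and> 0 \<le> r"
      using f pos' by (blast intro: less_imp_le)
  qed
  with pos' \<open>y \<ge> 0\<close> show ?thesis by simp
qed

text \<open>The bound r \<ge> k makes w strictly decreasing for y > 0 and gives w y \<le> w 0 - k
  y^2 / 2, which forces a sign change.\<close>

lemma unique_positive_zero:
  fixes w r :: "real \<Rightarrow> real"
  assumes w: "\<And>y. (w has_real_derivative - y * r y) (at y)"
    and "k > 0" "w 0 > 0" and r: "\<And>y. y \<ge> 0 \<Longrightarrow> r y \<ge> k"
  shows "\<exists>!y. y > 0 \<and> w y = 0"
proof -
  \<comment> \<open>The point x is kept away from 0, where the derivative of w vanishes.\<close>
  have dec: "w y < w x" if "0 < x" "x < y" for x y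
  proof (rule DERIV_neg_imp_decreasing[OF that(2)])
    fix t assume "x \<le> t" "t \<le> y"
    then have "t > 0" "r t > 0" using r[of t] \<open>k > 0\<close> that by auto
    then show "\<exists>z. (w has_real_derivative z) (at t) \<and> z < 0"
      using w[of t] by (intro exI conjI) (auto simp: mult_less_0_iff)
  qed
  \<comment> \<open>This is the positive zero of the bounding parabola w 0 - k y^2 / 2, so w b \<le>
    0.\<close>
  define b where "b = sqrt (2 * w 0 / k)"
  have "b > 0" using assms by (simp add: b_def)
  have "w b + k * b\<^sup>2 / 2 \<le> w 0 + k * 0\<^sup>2 / 2"
  proof (rule DERIV_nonpos_imp_nonincreasing[where f = "\<lambda>x. w x + k * x\<^sup>2 / 2"])
    fix t :: real assume "0 \<le> t"
    have "((\<lambda>x. w x + k * x\<^sup>2 / 2) has_real_derivative - (t * (r t - k))) (at t)"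
      by (rule derivative_eq_intros DERIV_chain2[OF w] refl | simp)+ (simp add: algebra_simps)
    moreover have "- (t * (r t - k)) \<le> 0" using \<open>0 \<le> t\<close> r[of t] by simp
    ultimately show "\<exists>z. ((\<lambda>x. w x + k * x\<^sup>2 / 2) has_real_derivative z) (at t) \<and> z \<le> 0" by blast
  qed (use \<open>b > 0\<close> in simp)
  moreover have "k * b\<^sup>2 / 2 = w 0" using assms by (simp add: b_def)
  ultimately have "w b \<le> 0" by simp
  moreover have "continuous_on {0..b} w"
    using w by (meson DERIV_isCont continuous_at_imp_continuous_on)
  ultimately obtain x where "0 \<le> x" "w x = 0"
    using IVT2'[of w b 0 0] \<open>w 0 > 0\<close> \<open>b > 0\<close> by auto
  moreover have "x \<noteq> 0" using \<open>w x = 0\<close> \<open>w 0 > 0\<close> by auto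
  ultimately have "x > 0 \<and> w x = 0" by simp
  then show ?thesis
  proof (rule ex1I)
    fix y assume "y > 0 \<and> w y = 0"
    then show "y = x" using dec[of x y] dec[of y x] \<open>x > 0 \<and> w x = 0\<close> by (cases x y rule: linorder_cases) auto
  qed
qed

text \<open>The equation f y = y f' y says that the tangent at y passes through the origin. As f y >
  0, a multiple of f then touches the diagonal at y with slope 1, which is the smooth fit of the
  free boundary problem.\<close>

lemma ODE_positive_and_unique_tangent:
  fixes f f' :: "real \<Rightarrow> real"
  assumes f: "\<And>y. (f has_real_derivative f' y) (at y)"
    and f': "\<And>y. (f' has_real_derivative a * y * f' y + f y) (at y)"
    and "a > -1" "f 0 > 0" "f' 0 > 0"
  shows "\<forall>y\<ge>0. f y > 0" "\<exists>!y. y > 0 \<and> f y = y * f' y"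
proof -
  note [derivative_intros] = DERIV_chain2[OF f] DERIV_chain2[OF f']
  have "(\<forall>y\<ge>0. f y > 0) \<and> (\<exists>!y. y > 0 \<and> f y = y * f' y)"
  proof (cases "a \<ge> 0")
    case True
    have inc: "f' y > 0 \<and> f y \<ge> f 0" if "y \<ge> 0" for y
      using second_order_ODE_increasing[of f f' a 1] that assms True by simp
    have "\<exists>!y. y > 0 \<and> f y - y * f' y = 0"
    proof (rule unique_positive_zero[where r = "\<lambda>y. a * y * f' y + f y" and k = "f 0"])
      show "((\<lambda>y. f y - y * f' y) has_real_derivative - y * (a * y * f' y + f y)) (at y)" for y
        by (rule derivative_eq_intros refl | simp)+
      show "a * y * f' y + f y \<ge> f 0" if "y \<ge> 0" for y
        using inc[OF that] True that by (smt (verit) mult_nonneg_nonneg)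
    qed (use \<open>f 0 > 0\<close> in auto)
    moreover have "f y > 0" if "y \<ge> 0" for y
      using inc[OF that] \<open>f 0 > 0\<close> by linarith
    ultimately show ?thesis by simp
  next
    case False
    \<comment> \<open>For a < 0 the term a y f' has the wrong sign when f' > 0. The product f e
      satisfies an equation with coefficients - a and 1 - a, both positive.\<close>
    define e where "e = (\<lambda>y. exp (- a * y\<^sup>2 / 2))"
    have e_pos: "e y > 0" for y by (simp add: e_def)
    have [derivative_intros]: "(e has_real_derivative - a * y * e y) (at y)" for y
      unfolding e_def by (rule derivative_eq_intros refl | simp)+
    have inc: "f y * e y \<ge> f 0" if "y \<ge> 0" for y
    proof -
      have "f y * e y \<ge> f 0 * e 0"
      proof (rule conjunct2[OF second_order_ODE_increasing[where
              f = "\<lambda>y. f y * e y" and f' = "\<lambda>y. (f' y - a * y * f y) * e y" and c = "- a" and d = "1 - a"]])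
        show "((\<lambda>y. f y * e y) has_real_derivative (f' y - a * y * f y) * e y) (at y)" for y
          by (rule derivative_eq_intros refl | simp)+ (simp add: algebra_simps)
        show "((\<lambda>y. (f' y - a * y * f y) * e y) has_real_derivative
            - a * y * ((f' y - a * y * f y) * e y) + (1 - a) * (f y * e y)) (at y)" for y
          by (rule derivative_eq_intros refl | simp)+ (simp add: algebra_simps)
      qed (use False that assms e_pos in auto)
      then show ?thesis by (simp add: e_def)
    qed
    have "\<exists>!y. y > 0 \<and> (f y - y * f' y) * e y = 0"
    \<comment> \<open>The weight cancels the f' terms in the derivative, and a > -1 makes the
      remaining factor 1 + a positive.\<close>
    proof (rule unique_positive_zero[where r = "\<lambda>y. (1 + a) * (f y * e y)" and k = "(1 + a) * f 0"])
      show "((\<lambda>y. (f y - y * f' y) * e y) has_real_derivative - y * ((1 + a) * (f y * e y))) (at y)" for y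
        by (rule derivative_eq_intros refl | simp)+ (simp add: algebra_simps)
      show "(1 + a) * (f y * e y) \<ge> (1 + a) * f 0" if "y \<ge> 0" for y
        using inc[OF that] \<open>a > -1\<close> by simp
    qed (use assms e_pos in auto)
    moreover have "f y > 0" if "y \<ge> 0" for y
      using inc[OF that] \<open>f 0 > 0\<close> e_pos[of y] by (smt (verit) zero_less_mult_pos2)
    ultimately show ?thesis using e_pos by (simp add: less_imp_neq[symmetric])
  qed
  then show "\<forall>y\<ge>0. f y > 0" "\<exists>!y. y > 0 \<and> f y = y * f' y" by blast+
qed

section \<open>The function \<open>F\<close>, its boundary point and its scaling\<close>

lemma F_ODE:
  assumes "\<alpha> > 0" "\<alpha> \<noteq> 1 / 2"
  obtains f' where
    "\<And>y. (F \<alpha> has_real_derivative f' y) (at y)"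
    "\<And>y. (f' has_real_derivative (2 * \<alpha> - 1) * y * f' y + F \<alpha> y) (at y)"
    "F \<alpha> 0 > 0" "f' 0 = 1"
proof -
  define a where "a = 2 * \<alpha> - 1"
  \<comment> \<open>Both branches of \<open>F\<close> have the same shape; only this Gamma quotient,
    the value of \<open>F\<close> at y = 0, differs.\<close>
  define K where "K = (if \<alpha> < 1 / 2
    then Gamma (1 - \<gamma>_par \<alpha>) / (sqrt (2 * (1 - 2 * \<alpha>)) * Gamma (3 / 2 - \<gamma>_par \<alpha>))
    else Gamma (\<gamma>_par \<alpha> - 1 / 2) / (sqrt (2 * (2 * \<alpha> - 1)) * Gamma (\<gamma>_par \<alpha>)))"
  have "a \<noteq> 0" using assms by (simp add: a_def)
  have \<gamma>: "\<gamma>_par \<alpha> = 1 / (2 * a) + 1 / 2"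
    using assms by (simp add: \<gamma>_par_def a_def field_simps)
  have K_pos: "K > 0"
  proof (cases "\<alpha> < 1 / 2")
    case True
    \<comment> \<open>This makes both Gamma arguments, 1 - \<gamma> and 3/2 - \<gamma>, positive; in
      the other case \<gamma> > 1/2 does so for \<gamma> - 1/2 and \<gamma>.\<close>
    then have "\<gamma>_par \<alpha> < 1" using assms by (simp add: \<gamma>_par_def field_simps)
    then show ?thesis using True by (auto simp: K_def intro!: divide_pos_pos mult_pos_pos Gamma_real_pos)
  next
    case False
    then have "\<gamma>_par \<alpha> > 1 / 2" using assms \<gamma> by (simp add: a_def)
    then show ?thesis using False assms by (auto simp: K_def intro!: divide_pos_pos mult_pos_pos Gamma_real_pos)
  qed
  have F: "F \<alpha> = (\<lambda>y. y * kummer_M (1 / (2 * a) + 1 / 2) (3 / 2) (y\<^sup>2 * a / 2)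
                  + K * kummer_M (1 / (2 * a)) (1 / 2) (y\<^sup>2 * a / 2))"
    by (auto simp: F_def K_def z_arg_def \<gamma> a_def[symmetric] fun_eq_iff)
  show ?thesis
  proof (rule kummer_combination_ODE[OF \<open>a \<noteq> 0\<close> F])
    fix f'
    assume "\<And>y. (F \<alpha> has_real_derivative f' y) (at y)"
      "\<And>y. (f' has_real_derivative a * y * f' y + F \<alpha> y) (at y)"
      "F \<alpha> 0 = K" "f' 0 = 1"
    then show ?thesis using K_pos by (intro that[of f']) (simp_all add: a_def)
  qed
qed

lemma boundary_and_scaling_unique:
  assumes "\<alpha> > 0" "\<alpha> \<noteq> 1 / 2"
  shows "\<exists>!B. is_boundary \<alpha> B" "\<exists>!C. boundary \<alpha> = C * F \<alpha> (boundary \<alpha>)"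
proof -
  obtain f' where f':
    "\<And>y. (F \<alpha> has_real_derivative f' y) (at y)"
    "\<And>y. (f' has_real_derivative (2 * \<alpha> - 1) * y * f' y + F \<alpha> y) (at y)"
    "F \<alpha> 0 > 0" "f' 0 = 1"
    by (rule F_ODE[OF assms]) blast
  note tangent = ODE_positive_and_unique_tangent[OF f'(1,2)]
  have pos: "F \<alpha> y > 0" if "y > 0" for y
    using tangent(1) f' assms that by simp
  have "deriv (F \<alpha>) = f'" using DERIV_imp_deriv[OF f'(1)] by blast
  \<comment> \<open>If f' B = 0, both sides are false: the quotient is 0 by convention,
    contradicting B > 0, while F = B f' would contradict F > 0.\<close>
  then have "is_boundary \<alpha> B \<longleftrightarrow> B > 0 \<and> F \<alpha> B = B * f' B" for B
    using pos[of B] by (cases "f' B = 0") (auto simp: is_boundary_def field_simps)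
  then show ex1: "\<exists>!B. is_boundary \<alpha> B" using tangent(2) f' assms by simp
  have "is_boundary \<alpha> (boundary \<alpha>)"
    unfolding boundary_def by (rule theI'[OF ex1])
  then have "F \<alpha> (boundary \<alpha>) > 0" using pos by (simp add: is_boundary_def)
  then show "\<exists>!C. boundary \<alpha> = C * F \<alpha> (boundary \<alpha>)"
    by (intro ex1I[of _ "boundary \<alpha> / F \<alpha> (boundary \<alpha>)"]) (auto simp: field_simps)
qed

section \<open>The equation below the boundary and the case \<alpha> = 1/2\<close>

text \<open>Derivatives are local and the half-line below B is open, so f inherits both derivatives
  from g there, whatever its values from B on.\<close>

lemma solves_ODE_belowI:
  assumes f: "\<And>y. y < B \<Longrightarrow> f y = g y"
    and g: "\<And>y. y < B \<Longrightarrow> (g has_real_derivative g' y) (at y)"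
    and g': "\<And>y. y < B \<Longrightarrow> (g' has_real_derivative (2 * \<alpha> - 1) * y * g' y + g y) (at y)"
  shows "solves_ODE_below \<alpha> B f"
proof -
  have df: "(f has_real_derivative g' y) (at y)" if "y < B" for y
    using g[OF that] has_field_derivative_transform_within_open[of g _ y "{..<B}" f] f that by auto
  then have deriv_f: "deriv f y = g' y" if "y < B" for y
    using that by (simp add: DERIV_imp_deriv)
  have ddf: "(deriv f has_real_derivative (2 * \<alpha> - 1) * y * g' y + g y) (at y)" if "y < B" for y
    using g'[OF that] has_field_derivative_transform_within_open[of g' _ y "{..<B}" "deriv f"] deriv_f that
    by auto
  show ?thesis
    unfolding solves_ODE_below_def
    using df ddf deriv_f f DERIV_imp_deriv[OF ddf] by (auto simp: real_differentiable_def)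
qed

text \<open>The equation is linear and homogeneous, so it passes from \<open>F\<close> to its
  multiples.\<close>

lemma f_sol_solves_ODE:
  assumes "\<alpha> > 0" "\<alpha> \<noteq> 1 / 2"
  shows "solves_ODE_below \<alpha> (boundary \<alpha>) (f_sol \<alpha>)"
proof -
  obtain f' where f':
    "\<And>y. (F \<alpha> has_real_derivative f' y) (at y)"
    "\<And>y. (f' has_real_derivative (2 * \<alpha> - 1) * y * f' y + F \<alpha> y) (at y)"
    by (rule F_ODE[OF assms]) blast
  show ?thesis
  proof (rule solves_ODE_belowI)
    fix y
    show "((\<lambda>y. scaling \<alpha> * F \<alpha> y) has_real_derivative scaling \<alpha> * f' y) (at y)"
      by (rule DERIV_cmult[OF f'(1)])
    show "((\<lambda>y. scaling \<alpha> * f' y) has_real_derivative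
        (2 * \<alpha> - 1) * y * (scaling \<alpha> * f' y) + scaling \<alpha> * F \<alpha> y) (at y)"
      using DERIV_cmult[OF f'(2), of "scaling \<alpha>" y] by (simp add: algebra_simps)
  qed (simp add: f_sol_def)
qed

text \<open>At \<alpha> = 1/2 the equation is f'' = f, and decay at minus infinity leaves C e^y.
  Such an f equals f', so the two boundary conditions force B = 1 and C = 1/e.\<close>

lemma exp_linear_solves_FBP:
  "solves_FBP (1 / 2) 1 (\<lambda>y. if y < 1 then exp (y - 1) else y)" (is "solves_FBP _ _ ?f")
proof -
  \<comment> \<open>The minimum merges the slopes e^(y - 1) and 1 into one visibly continuous
    formula.\<close>
  have D: "(?f has_real_derivative exp (min (y - 1) 0)) (at y)" for y
  proof -
    \<comment> \<open>The closures of the two pieces meet only at 1, where both branches have value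
      1 and slope 1.\<close>
    have "((\<lambda>y. if y \<in> {..<1} then exp (y - 1) else y) has_vector_derivative
        (if y \<in> {..<1} then exp (y - 1) else 1)) (at y within {..<1} \<union> {1..})"
      by (rule has_vector_derivative_If_within_closures)
        (auto simp: has_real_derivative_iff_has_vector_derivative[symmetric] intro!: derivative_eq_intros)
    moreover have "{..<1} \<union> {1..} = (UNIV :: real set)" by auto
    ultimately show ?thesis
      by (auto simp: has_real_derivative_iff_has_vector_derivative split: if_splits)
  qed
  have "?f C1_differentiable_on UNIV"
    unfolding C1_differentiable_on_def
    using D by (intro exI[of _ "\<lambda>y. exp (min (y - 1) 0)"])
      (auto simp: has_real_derivative_iff_has_vector_derivative intro!: continuous_intros)
  moreover have "solves_ODE_below (1 / 2) 1 ?f"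
    by (rule solves_ODE_belowI[where g = "\<lambda>y. exp (y - 1)" and g' = "\<lambda>y. exp (y - 1)"])
      (auto intro!: derivative_eq_intros)
  moreover have "deriv ?f 1 = 1" using DERIV_imp_deriv[OF D, of 1] by simp
  moreover have "(?f \<longlongrightarrow> 0) at_bot"
  proof (rule Lim_transform_eventually)
    have "((\<lambda>y :: real. exp y * exp (- 1)) \<longlongrightarrow> 0 * exp (- 1)) at_bot"
      by (intro tendsto_intros exp_at_bot)
    then show "((\<lambda>y :: real. exp (y - 1)) \<longlongrightarrow> 0) at_bot"
      by (simp add: exp_add[symmetric])
    show "\<forall>\<^sub>F y in at_bot. exp (y - 1) = ?f y"
      using eventually_gt_at_bot[of 1] eventually_at_bot_dense by (auto simp: eventually_at_bot_dense)
  qed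
  ultimately show ?thesis by (simp add: solves_FBP_def)
qed

theorem theorem1:
  shows "(\<forall>\<alpha>. \<alpha> > 0 \<and> \<alpha> \<noteq> 1/2 \<longrightarrow>
            (\<exists>!B. is_boundary \<alpha> B) \<and> (\<exists>!C. boundary \<alpha> = C * F \<alpha> (boundary \<alpha>)))
       \<and> (\<forall>\<alpha>. 0 < \<alpha> \<and> \<alpha> < 1/2 \<longrightarrow> solves_ODE_below \<alpha> (boundary \<alpha>) (f_sol \<alpha>))
       \<and> solves_FBP (1/2) 1 (\<lambda>y. if y < 1 then exp (y - 1) else y)
       \<and> (\<forall>\<alpha>. \<alpha> > 1/2 \<longrightarrow> solves_ODE_below \<alpha> (boundary \<alpha>) (f_sol \<alpha>))"
  using boundary_and_scaling_unique f_sol_solves_ODE exp_linear_solves_FBP by auto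

end
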